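(* Let $N\ge \ell\ge 2$ be integers, let $A\subseteq\mathbb Z_{\ge0}$, and let $\vec\nu=(\nu_1,\nu_2,\dots)$ be nonnegative integers with $\sum_r r\nu_r=N$. Let $Q_A(\vec\nu,\ell)$ be the number of permutations $s$ of $[N]=\{1,\dots,N\}$ having exactly $\nu_r$ cycles of length $r$ for each $r$, such that for every cycle of $s$ the number of elements of $[\ell]=\{1,\dots,\ell\}$ in that cycle belongs to $A$. Then \[ Q_A(\vec\nu,\ell)=(N-\ell)!\,\ell!\,[w^\ell]\prod_{r\ge1}\frac{1}{\nu_r!}\left(\frac{\sum_{a\in A}\binom{r}{a}w^a}{r}\right)^{\nu_r}. \]
   Context: $[w^\ell]F(w)$ denotes the coefficient of $w^\ell$ in the power series $F(w)$; $\binom{r}{a}=0$ for $a>r$. *)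

theory Defs
  imports
    "HOL-Combinatorics.Orbits"
    "HOL-Computational_Algebra.Formal_Power_Series"
begin

text \<open>
  A cycle is represented by its underlying set of elements, so its length is the cardinality of
  that set. Fixed points in \<^term>\<open>S\<close> count as cycles of length 1.
\<close>

definition cycles_on :: "'a set \<Rightarrow> ('a \<Rightarrow> 'a) \<Rightarrow> 'a set set" where
  "cycles_on S s = orbit s ` S"

text \<open>
  A sequence \<open>(\<nu> 1, \<nu> 2, \<dots>)\<close> is encoded as a function on \<^typ>\<open>nat\<close>;
  the value at 0 carries no meaning and is ignored throughout.
  Sums and products over all \<open>r \<ge> 1\<close> are taken over the support, outside of which the terms
  \<open>r * \<nu> r\<close> are 0 and the factors \<open>1 / (\<nu> r)! * (\<dots>) ^ \<nu> r\<close> are 1.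
\<close>

definition nu_support :: "(nat \<Rightarrow> nat) \<Rightarrow> nat set" where
  "nu_support \<nu> = {r. 1 \<le> r \<and> \<nu> r \<noteq> 0}"

definition Q :: "nat \<Rightarrow> nat set \<Rightarrow> (nat \<Rightarrow> nat) \<Rightarrow> nat \<Rightarrow> nat" where
  "Q N A \<nu> l = card {s. s permutes {1..N} \<and>
     (\<forall>r\<ge>1. card {C \<in> cycles_on {1..N} s. card C = r} = \<nu> r) \<and>
     (\<forall>C \<in> cycles_on {1..N} s. card (C \<inter> {1..l}) \<in> A)}"

text \<open>The series with coefficients \<open>r choose a\<close> for \<open>a \<in> A\<close>; these vanish for \<open>a > r\<close>.\<close>

definition binomial_fps :: "nat set \<Rightarrow> nat \<Rightarrow> rat fps" where
  "binomial_fps A r = Abs_fps (\<lambda>a. if a \<in> A then of_nat (r choose a) else 0)"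

end

theory Submission
  imports Defs
begin

text \<open>
  Count pairs \<open>(s, C)\<close> of an admissible permutation \<open>s\<close> and a cycle \<open>C\<close> of \<open>s\<close> of a fixed length
  \<open>r\<close> with \<open>\<nu> r > 0\<close>. There are \<open>\<nu> r\<close> choices of \<open>C\<close> for every \<open>s\<close>. Conversely, a set \<open>C\<close> with \<open>r\<close>
  elements, \<open>a \<in> A\<close> of them marked, carries \<open>(r - 1)!\<close> cyclic permutations, and the rest of \<open>s\<close> is
  an admissible permutation of the complement of \<open>C\<close>, of the type with one \<open>r\<close>-cycle less. After
  division by the factorials of the numbers of marked and unmarked points, the resulting recursion
  is the one obtained by splitting off one factor \<open>(\<Sum>a\<in>A. (r choose a) w^a) / r\<close> of the
  generating function.
\<close>

section \<open>Cycles of a permutation as subsets of the ground set\<close>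

text \<open>This form allows \<open>C\<close> to be chosen first, among the subsets of
  \<open>S\<close>, and the permutation afterwards, as double counting requires.\<close>

lemma mem_cycles_on_iff:
  assumes "s permutes S" "finite S"
  shows "C \<in> cycles_on S s \<longleftrightarrow> C \<subseteq> S \<and> cyclic_on s C"
proof
  assume "C \<in> cycles_on S s"
  then obtain x where "x \<in> S" "C = orbit s x" by (auto simp: cycles_on_def)
  then show "C \<subseteq> S \<and> cyclic_on s C"
    using permutes_orbit_subset[OF assms(1)] cyclic_on_orbit[OF assms] by blast
next
  assume "C \<subseteq> S \<and> cyclic_on s C"
  then show "C \<in> cycles_on S s"
    unfolding cycles_on_def cyclic_on_def by blast
qed

text \<open>A set on which \<open>s\<close> is cyclic is the orbit of each of its points. Hence
  permutations can be classified, without overlap, by the cycle through a fixed point.\<close>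

lemma cycles_on_unique:
  assumes "s permutes S" "finite S" "x \<in> S"
  shows "C \<in> cycles_on S s \<and> x \<in> C \<longleftrightarrow> C = orbit s x"
proof
  assume "C \<in> cycles_on S s \<and> x \<in> C"
  then show "C = orbit s x"
    using orbit_cyclic_eq3[of s C x] by (simp add: mem_cycles_on_iff[OF assms(1,2)])
next
  assume "C = orbit s x"
  moreover have "x \<in> orbit s x"
    using assms by (intro permutation_self_in_orbit) (auto simp: permutation_permutes)
  ultimately show "C \<in> cycles_on S s \<and> x \<in> C"
    using assms by (simp add: cycles_on_def)
qed

lemma finite_cycles_on: "finite S \<Longrightarrow> finite (cycles_on S s)"
  by (simp add: cycles_on_def)

section \<open>Splitting one cycle off a permutation\<close>

text \<open>The condition \<open>c permutes C\<close> forces \<open>c\<close> to be the identity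
  outside \<open>C\<close>, so each cyclic arrangement of \<open>C\<close> is counted once.\<close>

definition cyclic_perms :: "'a set \<Rightarrow> ('a \<Rightarrow> 'a) set" where
  "cyclic_perms C = {c. c permutes C \<and> cyclic_on c C}"

text \<open>The two permutations move disjoint sets of points, so the composition acts as
  \<open>c\<close> on \<open>C\<close> and as \<open>t\<close> on \<open>S - C\<close>, and orbits
  can be computed separately on the two parts.\<close>

lemma cycles_on_comp:
  assumes "finite S" "C \<subseteq> S" and c: "c \<in> cyclic_perms C" and t: "t permutes S - C"
  shows "c \<circ> t permutes S" "C \<in> cycles_on S (c \<circ> t)"
    and "cycles_on S (c \<circ> t) - {C} = cycles_on (S - C) t"
proof -
  have cC: "c permutes C" "cyclic_on c C" using c by (auto simp: cyclic_perms_def)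
  show p: "c \<circ> t permutes S"
    using assms(2) permutes_subset[OF cC(1) assms(2)] permutes_subset[OF t, of S]
    by (auto intro: permutes_compose)
  have eqC: "(c \<circ> t) y = c y" if "y \<in> C" for y
    using that permutes_not_in[OF t, of y] by simp
  have eqD: "(c \<circ> t) y = t y" if "y \<in> S - C" for y
  proof -
    have "t y \<in> S - C" using that permutes_in_image[OF t] by simp
    then show ?thesis using permutes_not_in[OF cC(1), of "t y"] by simp
  qed
  have "cyclic_on (c \<circ> t) C"
    using cC(2) eqC by (simp cong: cyclic_cong)
  then show C: "C \<in> cycles_on S (c \<circ> t)"
    using assms p by (simp add: mem_cycles_on_iff)
  have CC: "orbit (c \<circ> t) x = C" if "x \<in> C" for x
    using \<open>cyclic_on (c \<circ> t) C\<close> that by (rule orbit_cyclic_eq3)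
  have D: "orbit (c \<circ> t) x = orbit t x" if x: "x \<in> S - C" for x
  proof (rule orbit_cong)
    show "x \<in> orbit t x"
      using t \<open>finite S\<close> by (intro permutation_self_in_orbit) (auto simp: permutation_permutes)
    show "(c \<circ> t) y = t y" if "y \<in> orbit t x" for y
      using permutes_orbit_subset[OF t x] that eqD by blast
  qed
  have sub: "orbit t x \<subseteq> S - C" if "x \<in> S - C" for x
    using permutes_orbit_subset[OF t that] .
  \<comment> \<open>Every cycle of \<open>t\<close> is nonempty and disjoint from \<open>C\<close>,
    so deleting \<open>C\<close> from the cycles of \<open>c \<circ> t\<close> deletes no cycle of
    \<open>t\<close>.\<close>
  have "C \<notin> cycles_on (S - C) t"
    using sub orbit_nonempty[of t] by (fastforce simp: cycles_on_def)
  moreover have "cycles_on S (c \<circ> t) = insert C (cycles_on (S - C) t)"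
  proof -
    have "cycles_on S (c \<circ> t) = orbit (c \<circ> t) ` C \<union> orbit (c \<circ> t) ` (S - C)"
      unfolding cycles_on_def using assms(2) by blast
    also have "orbit (c \<circ> t) ` (S - C) = cycles_on (S - C) t"
      unfolding cycles_on_def using D by (intro image_cong refl)
    also have "orbit (c \<circ> t) ` C = {C}"
      using CC cC(2) unfolding cyclic_on_def by blast
    finally show ?thesis by (subst insert_is_Un)
  qed
  ultimately show "cycles_on S (c \<circ> t) - {C} = cycles_on (S - C) t"
    by simp
qed

text \<open>Gluing \<open>(c, t)\<close> to \<open>c \<circ> t\<close> is inverted by restricting to
  \<open>C\<close> and to \<open>S - C\<close>. Since \<open>P\<close> sees only the remaining
  cycles, it passes from \<open>s\<close> to \<open>t\<close> unchanged. The lemma serves both the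
  count of cyclic permutations and the recursion for admissible ones.\<close>

lemma card_permutes_with_cycle:
  assumes "finite S" "C \<subseteq> S"
  shows "card {s. s permutes S \<and> C \<in> cycles_on S s \<and> P (cycles_on S s - {C})}
    = card (cyclic_perms C) * card {t. t permutes S - C \<and> P (cycles_on (S - C) t)}"
    (is "card ?X = card ?K * card ?T")
proof -
  have "bij_betw (\<lambda>(c, t). c \<circ> t) (?K \<times> ?T) ?X"
  proof (rule bij_betw_byWitness[where f' = "\<lambda>s. (perm_restrict s C, perm_restrict s (S - C))"])
    show "(\<lambda>(c, t). c \<circ> t) ` (?K \<times> ?T) \<subseteq> ?X"
      using cycles_on_comp[OF assms] by auto
    have "perm_restrict (c \<circ> t) C = c" "perm_restrict (c \<circ> t) (S - C) = t"
      if "c \<in> ?K" and t: "t permutes S - C" for c t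
    proof -
      have c: "c permutes C" using that by (simp add: cyclic_perms_def)
      show "perm_restrict (c \<circ> t) C = c"
        using permutes_not_in[OF c] permutes_not_in[OF t]
        by (auto simp: perm_restrict_def)
      show "perm_restrict (c \<circ> t) (S - C) = t"
        using permutes_not_in[OF c] permutes_not_in[OF t] permutes_in_image[OF t]
        by (simp add: perm_restrict_def fun_eq_iff) blast
    qed
    then show "\<forall>ct\<in>?K \<times> ?T. (\<lambda>s. (perm_restrict s C, perm_restrict s (S - C))) ((\<lambda>(c, t). c \<circ> t) ct) = ct"
      by simp
    have *: "perm_restrict s C \<in> ?K" "perm_restrict s (S - C) permutes S - C"
      "perm_restrict s C \<circ> perm_restrict s (S - C) = s"
      if s: "s permutes S" "C \<in> cycles_on S s" for s
    proof -
      have cyc: "cyclic_on s C" using s assms by (simp add: mem_cycles_on_iff)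
      show t: "perm_restrict s (S - C) permutes S - C"
        by (rule perm_restrict_diff_cyclic[OF s(1) cyc])
      \<comment> \<open>A cycle is mapped into itself; injectivity and finiteness make the map
        onto.\<close>
      have "bij_betw s C C"
      proof -
        have "s ` C \<subseteq> C" using cyclic_on_inI[OF cyc] by blast
        moreover have "inj_on s C" using s(1) by (rule permutes_inj_on)
        ultimately show ?thesis
          using endo_inj_surj[of C s] finite_subset[OF assms(2,1)] by (simp add: bij_betw_def)
      qed
      then have "bij_betw (perm_restrict s C) C C"
        by (subst bij_betw_cong[of C _ s]) (simp_all add: perm_restrict_simps)
      then have c: "perm_restrict s C permutes C"
        by (rule bij_imp_permutes) (simp add: perm_restrict_simps)
      with cyc show "perm_restrict s C \<in> ?K"
        by (simp add: cyclic_perms_def cyclic_on_perm_restrict)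
      have "perm_restrict s C \<circ> perm_restrict s (S - C) = perm_restrict s (C \<union> (S - C))"
        by (rule perm_restrict_union[OF c t]) blast
      also have "C \<union> (S - C) = S" using assms by blast
      finally show "perm_restrict s C \<circ> perm_restrict s (S - C) = s" by (simp only: perm_restrict_id[OF s(1)])
    qed
    show "\<forall>s\<in>?X. (\<lambda>(c, t). c \<circ> t) (perm_restrict s C, perm_restrict s (S - C)) = s"
      using *(3) by simp
    show "(\<lambda>s. (perm_restrict s C, perm_restrict s (S - C))) ` ?X \<subseteq> ?K \<times> ?T"
    proof safe
      fix s assume s: "s permutes S" "C \<in> cycles_on S s" "P (cycles_on S s - {C})"
      note s' = *[OF s(1,2)]
      show "perm_restrict s C \<in> ?K" "perm_restrict s (S - C) permutes S - C"
        using s' by auto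
      show "P (cycles_on (S - C) (perm_restrict s (S - C)))"
        using cycles_on_comp(3)[OF assms s'(1,2)] s'(3) s(3) by simp
    qed
  qed
  from bij_betw_same_card[OF this] show ?thesis
    by (simp only: card_cartesian_product)
qed

section \<open>Subsets by number of marked elements; cyclic permutations\<close>

text \<open>A set \<open>C\<close> amounts to independent choices of its marked part
  \<open>C \<inter> L\<close> and its unmarked part \<open>C - L\<close>, with \<open>a\<close> and
  \<open>r - a\<close> elements.\<close>

lemma sum_subsets_by_card_Int:
  fixes h :: "nat \<Rightarrow> 'b::comm_semiring_1"
  assumes "finite S"
  shows "(\<Sum>C | C \<subseteq> S \<and> card C = r. h (card (C \<inter> L))) =
    (\<Sum>a\<le>r. of_nat ((card (S \<inter> L) choose a) * (card (S - L) choose (r - a))) * h a)"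
proof -
  let ?X = "{C. C \<subseteq> S \<and> card C = r}"
  have fin: "finite ?X" using assms by simp
  have *: "card {C \<in> ?X. card (C \<inter> L) = a} = (card (S \<inter> L) choose a) * (card (S - L) choose (r - a))"
    if a: "a \<le> r" for a
  proof -
    have "bij_betw (\<lambda>C. (C \<inter> L, C - L)) {C \<in> ?X. card (C \<inter> L) = a}
      ({X. X \<subseteq> S \<inter> L \<and> card X = a} \<times> {Y. Y \<subseteq> S - L \<and> card Y = r - a})"
    proof (rule bij_betw_byWitness[where f' = "\<lambda>(X, Y). X \<union> Y"])
      show "(\<lambda>C. (C \<inter> L, C - L)) ` {C \<in> ?X. card (C \<inter> L) = a}
        \<subseteq> {X. X \<subseteq> S \<inter> L \<and> card X = a} \<times> {Y. Y \<subseteq> S - L \<and> card Y = r - a}"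
        using assms by (auto simp: card_Diff_subset_Int finite_subset)
      show "(\<lambda>(X, Y). X \<union> Y) ` ({X. X \<subseteq> S \<inter> L \<and> card X = a} \<times> {Y. Y \<subseteq> S - L \<and> card Y = r - a})
        \<subseteq> {C \<in> ?X. card (C \<inter> L) = a}"
      proof safe
        fix X Y assume XY: "X \<subseteq> S \<inter> L" "Y \<subseteq> S - L" "card Y = r - card X" "a = card X"
        then have "finite X" "finite Y" "X \<inter> Y = {}" "(X \<union> Y) \<inter> L = X"
          using assms by (auto intro: finite_subset)
        then show "card (X \<union> Y) = r" "card ((X \<union> Y) \<inter> L) = card X"
          using XY a by (simp_all add: card_Un_disjoint)
      qed auto
    qed auto
    then show ?thesis
      using assms by (simp only: bij_betw_same_card card_cartesian_product n_subsets finite_Int finite_Diff simp_thms)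
  qed
  have "(\<Sum>C\<in>?X. h (card (C \<inter> L))) = (\<Sum>a\<le>r. \<Sum>C\<in>{C \<in> ?X. card (C \<inter> L) = a}. h (card (C \<inter> L)))"
    using assms by (intro sum.group[symmetric] fin) (auto intro!: card_mono intro: finite_subset)
  also have "\<dots> = (\<Sum>a\<le>r. of_nat (card {C \<in> ?X. card (C \<inter> L) = a}) * h a)"
    by (intro sum.cong) auto
  finally show ?thesis using * by simp
qed

text \<open>
  Classifying the permutations of \<open>C\<close> by the cycle through a fixed element expresses
  \<open>fact (card C)\<close> as a sum whose only unknown term is the number of cyclic permutations of \<open>C\<close>
  itself, so no normal form for cyclic permutations is needed.
\<close>

lemma card_cyclic_perms:
  assumes "finite C" "C \<noteq> {}"
  shows "card (cyclic_perms C) = fact (card C - 1)"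
  using assms
proof (induction "card C" arbitrary: C rule: less_induct)
  case less
  define n where "n = card C - 1"
  have n: "card C = Suc n" using less.prems by (simp add: n_def card_gt_0_iff)
  obtain x where x: "x \<in> C" using less.prems by blast
  let ?Cs = "{D. D \<subseteq> C \<and> x \<in> D}"
  have fin: "finite ?Cs" using less.prems by simp
  have "fact (card C) = card {s. s permutes C}"
    using less.prems by (simp add: card_permutations)
  also have "{s. s permutes C} = (\<Union>D\<in>?Cs. {s. s permutes C \<and> D \<in> cycles_on C s})"
  proof (intro equalityI subsetI)
    fix s assume "s \<in> {s. s permutes C}"
    then have s: "s permutes C" by simp
    have "orbit s x \<in> cycles_on C s" "x \<in> orbit s x"
      using cycles_on_unique[OF s less.prems(1) x] by auto
    then show "s \<in> (\<Union>D\<in>?Cs. {s. s permutes C \<and> D \<in> cycles_on C s})"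
      using s mem_cycles_on_iff[OF s less.prems(1)] by auto
  qed auto
  also have "card \<dots> = (\<Sum>D\<in>?Cs. card {s. s permutes C \<and> D \<in> cycles_on C s})"
  proof (intro card_UN_disjoint fin ballI impI)
    show "finite {s. s permutes C \<and> D \<in> cycles_on C s}" for D
      by (rule finite_subset[OF _ finite_permutations[OF less.prems(1)]]) blast
    show "{s. s permutes C \<and> D \<in> cycles_on C s} \<inter> {s. s permutes C \<and> E \<in> cycles_on C s} = {}"
      if "D \<in> ?Cs" "E \<in> ?Cs" "D \<noteq> E" for D E
    proof -
      have False if s: "s permutes C" "D \<in> cycles_on C s" "E \<in> cycles_on C s" for s
        using cycles_on_unique[OF s(1) less.prems(1) x, of D]
          cycles_on_unique[OF s(1) less.prems(1) x, of E] s(2,3) \<open>D \<in> ?Cs\<close> \<open>E \<in> ?Cs\<close> \<open>D \<noteq> E\<close>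
        by simp
      then show ?thesis by blast
    qed
  qed
  \<comment> \<open>Once the cycle \<open>D\<close> through \<open>x\<close> is fixed, the rest is
    an arbitrary permutation of \<open>C - D\<close>, so \<open>P\<close> is taken to be constantly
    true.\<close>
  also have "\<dots> = (\<Sum>D\<in>?Cs. card (cyclic_perms D) * fact (card C - card D))"
  proof (intro sum.cong refl)
    fix D assume D: "D \<in> ?Cs"
    then have "finite D" using less.prems finite_subset by blast
    then have "card (C - D) = card C - card D" using D by (simp add: card_Diff_subset)
    with D show "card {s. s permutes C \<and> D \<in> cycles_on C s} = card (cyclic_perms D) * fact (card C - card D)"
      using card_permutes_with_cycle[of C D "\<lambda>_. True"] less.prems
      by (simp add: card_permutations)
  qed
  also have "\<dots> = card (cyclic_perms C)
      + (\<Sum>D\<in>?Cs - {C}. card (cyclic_perms D) * fact (card C - card D))"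
    using fin x by (subst sum.remove[of _ C]) auto
  also have "(\<Sum>D\<in>?Cs - {C}. card (cyclic_perms D) * fact (card C - card D))
      = (\<Sum>D\<in>?Cs - {C}. fact (card D - 1) * fact (card C - card D))"
  proof (intro sum.cong refl)
    fix D assume D: "D \<in> ?Cs - {C}"
    then have "card D < card C" "finite D" "D \<noteq> {}"
      using less.prems finite_subset[of D C] by (auto intro: psubset_card_mono)
    with D show "card (cyclic_perms D) * fact (card C - card D) = fact (card D - 1) * fact (card C - card D)"
      using less.hyps[of D] by simp
  qed
  finally have 1: "fact (card C) = card (cyclic_perms C)
      + (\<Sum>D\<in>?Cs - {C}. fact (card D - 1) * fact (card C - card D))" .
  \<comment> \<open>The same sum with the claimed value in place of the unknown term
    \<open>D = C\<close> also equals \<open>fact (card C)\<close>; comparison with the previous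
    equation gives the claim.\<close>
  have "fact (card C - 1) + (\<Sum>D\<in>?Cs - {C}. fact (card D - 1) * fact (card C - card D) :: nat)
      = (\<Sum>D\<in>?Cs. fact (card D - 1) * fact (card C - card D))"
    using fin x by (subst (2) sum.remove[of _ C]) auto
  \<comment> \<open>Deleting \<open>x\<close> turns the sum into one over all subsets of an
    \<open>n\<close>-element set. Grouped by size, each of the \<open>n + 1\<close> sizes
    contributes \<open>fact n\<close>.\<close>
  also have "\<dots> = (\<Sum>D\<in>Pow (C - {x}). fact (card D) * fact (n - card D))"
  proof (rule sum.reindex_bij_witness[where i = "insert x" and j = "\<lambda>D. D - {x}"])
    show "fact (card (D - {x})) * fact (n - card (D - {x})) = (fact (card D - 1) * fact (card C - card D) :: nat)"
      if "D \<in> ?Cs" for D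
    proof -
      have "finite D" using that less.prems by (auto intro: finite_subset)
      then have "card D = Suc (card (D - {x}))" using that by (metis (lifting) card.remove mem_Collect_eq)
      then show ?thesis by (simp add: n)
    qed
  qed (use x in auto)
  also have "\<dots> = (\<Sum>k\<le>n. \<Sum>D\<in>{D \<in> Pow (C - {x}). card D = k}. fact (card D) * fact (n - card D))"
  proof (intro sum.group[symmetric])
    show "card ` Pow (C - {x}) \<subseteq> {..n}"
      using less.prems x n card_mono[of "C - {x}"] by fastforce
  qed (use less.prems in auto)
  also have "\<dots> = (\<Sum>k\<le>n. (n choose k) * (fact k * fact (n - k)))"
  proof (intro sum.cong refl)
    fix k assume "k \<in> {..n}"
    have "card {D \<in> Pow (C - {x}). card D = k} = n choose k"
      using n_subsets[of "C - {x}" k] less.prems x n by simp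
    then show "(\<Sum>D\<in>{D \<in> Pow (C - {x}). card D = k}. fact (card D) * fact (n - card D)) =
        (n choose k) * (fact k * fact (n - k))"
      by simp
  qed
  also have "\<dots> = (\<Sum>k\<le>n. fact n)"
    by (intro sum.cong refl) (metis atMost_iff binomial_fact_lemma mult.commute)
  also have "\<dots> = fact (card C)" by (simp add: n)
  finally show ?case using 1 by simp
qed

unbundle fps_syntax

section \<open>Recursion for the number of admissible permutations\<close>

text \<open>The condition is put on a set of cycles rather than on a permutation, so that it can be
  stated for the cycles left after one is removed.\<close>

definition admissible :: "nat set \<Rightarrow> 'a set \<Rightarrow> (nat \<Rightarrow> nat) \<Rightarrow> 'a set set \<Rightarrow> bool" where
  "admissible A L \<nu> \<C> \<longleftrightarrow>
     (\<forall>r\<ge>1. card {C \<in> \<C>. card C = r} = \<nu> r) \<and> (\<forall>C\<in>\<C>. card (C \<inter> L) \<in> A)"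

lemma admissible_remove:
  assumes "finite \<C>" "C \<in> \<C>" "card C \<ge> 1" "\<nu> (card C) \<ge> 1"
  shows "admissible A L \<nu> \<C> \<longleftrightarrow>
    card (C \<inter> L) \<in> A \<and> admissible A L (\<nu>(card C := \<nu> (card C) - 1)) (\<C> - {C})"
proof -
  \<comment> \<open>Only the count for length \<open>card C\<close> changes, by one. As \<nu> is
    positive there, the truncated subtraction on the right is a true one.\<close>
  have "card {D \<in> \<C> - {C}. card D = k} = \<nu> k - (if k = card C then 1 else 0) \<longleftrightarrow>
      card {D \<in> \<C>. card D = k} = \<nu> k" for k
  proof (cases "k = card C")
    case True
    have "{D \<in> \<C>. card D = k} = insert C {D \<in> \<C> - {C}. card D = k}"
      using assms True by auto
    then have "card {D \<in> \<C>. card D = k} = Suc (card {D \<in> \<C> - {C}. card D = k})"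
      using assms(1) by simp
    then show ?thesis using assms True by auto
  next
    case False
    then have "{D \<in> \<C>. card D = k} = {D \<in> \<C> - {C}. card D = k}" by auto
    then show ?thesis using False by simp
  qed
  moreover have "(\<nu>(card C := \<nu> (card C) - 1)) k = \<nu> k - (if k = card C then 1 else 0)" for k
    by simp
  ultimately show ?thesis
    unfolding admissible_def using assms(2) by (simp only:) blast
qed

definition admissible_perms :: "nat set \<Rightarrow> 'a set \<Rightarrow> (nat \<Rightarrow> nat) \<Rightarrow> 'a set \<Rightarrow> ('a \<Rightarrow> 'a) set" where
  "admissible_perms A L \<nu> S = {s. s permutes S \<and> admissible A L \<nu> (cycles_on S s)}"

lemma card_admissible_perms_rec:
  assumes "finite S" "r \<in> nu_support \<nu>"
  shows "\<nu> r * card (admissible_perms A L \<nu> S) =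
    (\<Sum>C | C \<subseteq> S \<and> card C = r. if card (C \<inter> L) \<in> A
       then fact (r - 1) * card (admissible_perms A L (\<nu>(r := \<nu> r - 1)) (S - C)) else 0)"
proof -
  have r: "r \<ge> 1" "\<nu> r \<ge> 1" using assms(2) by (auto simp: nu_support_def)
  let ?X = "admissible_perms A L \<nu> S" and ?Cs = "{C. C \<subseteq> S \<and> card C = r}"
  have "{C \<in> ?Cs. C \<in> cycles_on S s} = {C \<in> cycles_on S s. card C = r}" if "s \<in> ?X" for s
    using that mem_cycles_on_iff[of s S] assms(1) by (auto simp: admissible_perms_def)
  then have "\<nu> r * card ?X = (\<Sum>s\<in>?X. card {C \<in> ?Cs. C \<in> cycles_on S s})"
    using r by (simp add: admissible_perms_def admissible_def)
  \<comment> \<open>Both sides count the pairs of a permutation and one of its cycles of length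
    \<open>r\<close>.\<close>
  also have "\<dots> = (\<Sum>C\<in>?Cs. card {s \<in> ?X. C \<in> cycles_on S s})"
    using assms(1) finite_subset[OF _ finite_permutations[OF assms(1)], of ?X]
    by (intro sum_multicount_gen) (auto simp: admissible_perms_def)
  also have "\<dots> = (\<Sum>C\<in>?Cs. if card (C \<inter> L) \<in> A
       then fact (r - 1) * card (admissible_perms A L (\<nu>(r := \<nu> r - 1)) (S - C)) else 0)"
  proof (intro sum.cong refl)
    fix C assume C: "C \<in> ?Cs"
    \<comment> \<open>The first conjunct does not depend on the remaining cycles; it becomes the
      case distinction on \<open>C\<close>.\<close>
    let ?P = "\<lambda>\<D>. card (C \<inter> L) \<in> A \<and> admissible A L (\<nu>(r := \<nu> r - 1)) \<D>"
    have "finite C" using C assms(1) finite_subset by blast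
    moreover have "C \<noteq> {}" using C r by auto
    ultimately have cp: "card (cyclic_perms C) = fact (r - 1)" using C by (simp add: card_cyclic_perms)
    have "{s \<in> ?X. C \<in> cycles_on S s}
        = {s. s permutes S \<and> C \<in> cycles_on S s \<and> ?P (cycles_on S s - {C})}"
      using C r admissible_remove[OF finite_cycles_on[OF assms(1)], of C _ \<nu> A L]
      by (auto simp: admissible_perms_def)
    also have "card \<dots> = fact (r - 1) * card {t. t permutes S - C \<and> ?P (cycles_on (S - C) t)}"
      using C card_permutes_with_cycle[OF assms(1), of C ?P] cp by simp
    finally show "card {s \<in> ?X. C \<in> cycles_on S s} = (if card (C \<inter> L) \<in> A
       then fact (r - 1) * card (admissible_perms A L (\<nu>(r := \<nu> r - 1)) (S - C)) else 0)"
      by (simp add: admissible_perms_def del: fun_upd_apply)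
  qed
  finally show ?thesis .
qed

section \<open>The generating function: recursion and degree bound\<close>

definition cycle_gf :: "nat set \<Rightarrow> (nat \<Rightarrow> nat) \<Rightarrow> rat fps" where
  "cycle_gf A \<nu> = (\<Prod>r\<in>nu_support \<nu>.
     fps_const (1 / fact (\<nu> r)) * (fps_const (1 / of_nat r) * binomial_fps A r) ^ \<nu> r)"

text \<open>Only the factor at \<open>r\<close> changes, and with \<open>\<nu> r = Suc k\<close> the
  identity is (k+1) X^(k+1) / (k+1)! = X X^k / k!.\<close>

lemma cycle_gf_rec:
  assumes "finite (nu_support \<nu>)" "r \<in> nu_support \<nu>"
  shows "of_nat (\<nu> r) * cycle_gf A \<nu> =
    fps_const (1 / of_nat r) * binomial_fps A r * cycle_gf A (\<nu>(r := \<nu> r - 1))"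
proof -
  define F where "F \<nu> r = fps_const (1 / fact (\<nu> r)) * (fps_const (1 / of_nat r) * binomial_fps A r) ^ \<nu> r"
    for \<nu> :: "nat \<Rightarrow> nat" and r
  let ?I = "nu_support \<nu>" and ?\<mu> = "\<nu>(r := \<nu> r - 1)"
  \<comment> \<open>If \<open>\<nu> r = 1\<close>, then \<open>r\<close> leaves the support; its
    factor is then 1, so the product may still run over the old support.\<close>
  have "cycle_gf A ?\<mu> = (\<Prod>k\<in>?I. F ?\<mu> k)"
    unfolding cycle_gf_def F_def
    by (rule prod.mono_neutral_left[OF assms(1)]) (auto simp: nu_support_def split: if_splits)
  also have "\<dots> = F ?\<mu> r * (\<Prod>k\<in>?I - {r}. F ?\<mu> k)"
    by (rule prod.remove[OF assms])
  also have "(\<Prod>k\<in>?I - {r}. F ?\<mu> k) = (\<Prod>k\<in>?I - {r}. F \<nu> k)"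
    by (intro prod.cong refl) (simp add: F_def)
  finally have 1: "cycle_gf A ?\<mu> = F ?\<mu> r * (\<Prod>k\<in>?I - {r}. F \<nu> k)" .
  have 2: "cycle_gf A \<nu> = F \<nu> r * (\<Prod>k\<in>?I - {r}. F \<nu> k)"
    unfolding cycle_gf_def F_def by (rule prod.remove[OF assms])
  obtain k where k: "\<nu> r = Suc k" using assms(2) by (auto simp: nu_support_def gr0_conv_Suc)
  have "of_nat (Suc k) * fps_const (1 / fact (Suc k) :: rat) = fps_const (1 / fact k)"
    by (simp only: fps_of_nat[symmetric] fps_const_mult) (simp add: divide_simps del: of_nat_Suc)
  then have "of_nat (Suc k) * (fps_const (1 / fact (Suc k)) * X ^ Suc k) = X * (fps_const (1 / fact k) * X ^ k)"
    for X :: "rat fps"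
    by (simp only: mult.assoc[symmetric]) (simp only: power_Suc mult_ac)
  then have "of_nat (\<nu> r) * F \<nu> r = fps_const (1 / of_nat r) * binomial_fps A r * F ?\<mu> r"
    unfolding F_def k by (simp only: fun_upd_same diff_Suc_1)
  then show ?thesis unfolding 1 2 by (simp add: mult.assoc[symmetric])
qed

text \<open>Vanishing beyond an index expresses a degree bound, and such bounds add under
  multiplication: if \<open>i\<close> is at most \<open>d\<close>, then \<open>n - i\<close> exceeds
  \<open>e\<close>.\<close>

lemma fps_mult_nth_eq_0:
  fixes f g :: "'a::comm_semiring_1 fps"
  assumes "\<And>n. n > d \<Longrightarrow> f $ n = 0" "\<And>n. n > e \<Longrightarrow> g $ n = 0" "n > d + e"
  shows "(f * g) $ n = 0"
  unfolding fps_mult_nth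
proof (intro sum.neutral ballI)
  fix i assume "i \<in> {0..n}"
  show "f $ i * g $ (n - i) = 0"
  proof (cases "i > d")
    case False
    then show ?thesis using assms(2)[of "n - i"] assms(3) by simp
  qed (simp add: assms(1))
qed

lemma fps_power_nth_eq_0:
  fixes f :: "'a::comm_semiring_1 fps"
  assumes "\<And>n. n > d \<Longrightarrow> f $ n = 0"
  shows "n > d * k \<Longrightarrow> (f ^ k) $ n = 0"
proof (induction k arbitrary: n)
  case (Suc k)
  then show ?case
    using fps_mult_nth_eq_0[of d f "d * k" "f ^ k" n] assms by simp
qed simp

lemma fps_prod_nth_eq_0:
  fixes f :: "'i \<Rightarrow> 'a::comm_semiring_1 fps"
  assumes "finite I" "\<And>i n. i \<in> I \<Longrightarrow> n > d i \<Longrightarrow> f i $ n = 0"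
  shows "n > (\<Sum>i\<in>I. d i) \<Longrightarrow> (\<Prod>i\<in>I. f i) $ n = 0"
  using assms
proof (induction I arbitrary: n)
  case (insert i I)
  have "(f i * (\<Prod>i\<in>I. f i)) $ n = 0"
    by (rule fps_mult_nth_eq_0[of "d i" _ "\<Sum>i\<in>I. d i"]) (use insert in auto)
  then show ?case using insert.hyps by simp
qed simp

text \<open>Each \<open>binomial_fps A r\<close> has degree at most \<open>r\<close>. The bound
  disposes of choices needing more unmarked points than there are.\<close>

lemma cycle_gf_nth_eq_0:
  assumes "finite (nu_support \<nu>)" "n > (\<Sum>r\<in>nu_support \<nu>. r * \<nu> r)"
  shows "cycle_gf A \<nu> $ n = 0"
  unfolding cycle_gf_def
proof (rule fps_prod_nth_eq_0[OF assms(1) _ assms(2)])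
  fix r n :: nat assume "n > r * \<nu> r"
  then have "((fps_const (1 / of_nat r) * binomial_fps A r) ^ \<nu> r) $ n = 0"
    by (rule fps_power_nth_eq_0[rotated]) (simp add: binomial_fps_def binomial_eq_0)
  then show "(fps_const (1 / fact (\<nu> r)) * (fps_const (1 / of_nat r) * binomial_fps A r) ^ \<nu> r) $ n = 0"
    by simp
qed

section \<open>Induction on the size of the ground set\<close>

lemma sum_nu_support_decrease:
  assumes "finite (nu_support \<nu>)" "r \<in> nu_support \<nu>"
  shows "finite (nu_support (\<nu>(r := \<nu> r - 1)))"
    and "(\<Sum>k\<in>nu_support \<nu>. k * \<nu> k) = r + (\<Sum>k\<in>nu_support (\<nu>(r := \<nu> r - 1)). k * (\<nu>(r := \<nu> r - 1)) k)"
proof -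
  let ?I = "nu_support \<nu>" and ?\<mu> = "\<nu>(r := \<nu> r - 1)"
  have sub: "nu_support ?\<mu> \<subseteq> ?I" by (auto simp: nu_support_def split: if_splits)
  show "finite (nu_support ?\<mu>)" using finite_subset[OF sub assms(1)] .
  have "(\<Sum>k\<in>nu_support ?\<mu>. k * ?\<mu> k) = (\<Sum>k\<in>?I. k * ?\<mu> k)"
    by (rule sum.mono_neutral_left[OF assms(1) sub]) (auto simp: nu_support_def)
  also have "\<dots> = r * (\<nu> r - 1) + (\<Sum>k\<in>?I - {r}. k * ?\<mu> k)"
    using sum.remove[OF assms, of "\<lambda>k. k * ?\<mu> k"] by simp
  also have "(\<Sum>k\<in>?I - {r}. k * ?\<mu> k) = (\<Sum>k\<in>?I - {r}. k * \<nu> k)"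
    by (intro sum.cong) auto
  finally have 1: "(\<Sum>k\<in>nu_support ?\<mu>. k * ?\<mu> k) = r * (\<nu> r - 1) + (\<Sum>k\<in>?I - {r}. k * \<nu> k)" .
  obtain k where "\<nu> r = Suc k" using assms(2) by (auto simp: nu_support_def gr0_conv_Suc)
  then show "(\<Sum>k\<in>?I. k * \<nu> k) = r + (\<Sum>k\<in>nu_support ?\<mu>. k * ?\<mu> k)"
    unfolding 1 sum.remove[OF assms] by simp
qed

text \<open>The ground set and the marked set are arbitrary because removing a cycle from
  \<open>{1..N}\<close> need not leave an interval. The induction compares the recursion for the
  permutations with that for \<open>cycle_gf\<close>.\<close>

lemma card_admissible_perms:
  assumes "finite S" "finite (nu_support \<nu>)" "(\<Sum>r\<in>nu_support \<nu>. r * \<nu> r) = card S"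
  shows "of_nat (card (admissible_perms A L \<nu> S)) =
    fact (card (S - L)) * fact (card (S \<inter> L)) * cycle_gf A \<nu> $ card (S \<inter> L)"
  using assms
proof (induction "card S" arbitrary: S \<nu> rule: less_induct)
  case less
  show ?case
  proof (cases "S = {}")
    case True
    then have "nu_support \<nu> = {}" using less.prems by (auto simp: nu_support_def)
    moreover from this True have "admissible_perms A L \<nu> S = {id}"
      by (auto simp: admissible_perms_def admissible_def cycles_on_def nu_support_def)
    ultimately show ?thesis using True by (simp add: cycle_gf_def)
  next
    case False
    then obtain r where r: "r \<in> nu_support \<nu>"
      using less.prems by (metis card_0_eq equals0I sum.empty)
    then have r0: "r \<ge> 1" "\<nu> r > 0" by (auto simp: nu_support_def)
    define \<mu> where "\<mu> = \<nu>(r := \<nu> r - 1)"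
    define l where "l = card (S \<inter> L)"
    define m where "m = card (S - L)"
    \<comment> \<open>By the induction hypothesis, \<open>h a\<close> is the contribution of one set
      \<open>C\<close> with \<open>a\<close> marked points, leaving \<open>l - a\<close> marked and
      \<open>m - (r - a)\<close> unmarked ones. Where these differences truncate, the binomial
      weights of \<open>h a\<close> below vanish.\<close>
    define h :: "nat \<Rightarrow> rat" where
      "h a = (if a \<in> A then fact (r - 1) * (fact (m - (r - a)) * fact (l - a) * cycle_gf A \<mu> $ (l - a)) else 0)"
      for a
    have lm: "card S = l + m"
      using card_Int_Diff[OF less.prems(1)] by (simp add: l_def m_def)
    note \<mu> = sum_nu_support_decrease[OF less.prems(2) r, folded \<mu>_def]
    have "of_nat (\<nu> r) * of_nat (card (admissible_perms A L \<nu> S)) =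
        (\<Sum>C | C \<subseteq> S \<and> card C = r. if card (C \<inter> L) \<in> A
           then fact (r - 1) * of_nat (card (admissible_perms A L \<mu> (S - C))) else 0 :: rat)"
      using arg_cong[OF card_admissible_perms_rec[OF less.prems(1) r, of A L], of "of_nat :: nat \<Rightarrow> rat"]
      by (simp add: \<mu>_def if_distrib[of of_nat] cong: if_cong)
    also have "\<dots> = (\<Sum>C | C \<subseteq> S \<and> card C = r. h (card (C \<inter> L)))"
    proof (intro sum.cong refl)
      fix C assume "C \<in> {C. C \<subseteq> S \<and> card C = r}"
      then have C: "C \<subseteq> S" "card C = r" by auto
      then have fin: "finite C" using less.prems finite_subset by blast
      have 1: "card (S - C) = card S - r" using C fin by (simp add: card_Diff_subset)
      have "card (S - C) < card S" using C r0 1 lm card_mono[OF less.prems(1) C(1)] by simp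
      moreover have "(\<Sum>k\<in>nu_support \<mu>. k * \<mu> k) = card (S - C)" using \<mu>(2) less.prems(3) 1 by simp
      ultimately have IH: "of_nat (card (admissible_perms A L \<mu> (S - C))) =
          fact (card (S - C - L)) * fact (card ((S - C) \<inter> L)) * cycle_gf A \<mu> $ card ((S - C) \<inter> L)"
        using less.hyps[of "S - C" \<mu>] less.prems(1) \<mu>(1) by simp
      have "(S - C) \<inter> L = (S \<inter> L) - (C \<inter> L)" "S - C - L = (S - L) - (C - L)" by auto
      then have "card ((S - C) \<inter> L) = l - card (C \<inter> L)" "card (S - C - L) = m - card (C - L)"
        using C(1) fin by (auto simp: l_def m_def intro!: card_Diff_subset)
      moreover have "card (C - L) = r - card (C \<inter> L)"
        using C(2) fin by (simp add: card_Diff_subset_Int)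
      ultimately show "(if card (C \<inter> L) \<in> A
           then fact (r - 1) * of_nat (card (admissible_perms A L \<mu> (S - C))) else 0 :: rat) = h (card (C \<inter> L))"
        by (simp add: IH h_def)
    qed
    also have "\<dots> = (\<Sum>a\<le>r. of_nat ((l choose a) * (m choose (r - a))) * h a)"
      unfolding l_def m_def by (rule sum_subsets_by_card_Int[OF less.prems(1)])
    \<comment> \<open>The range changes to that of the Cauchy product at index \<open>l\<close>;
      terms in only one of the ranges vanish because \<open>l choose a\<close> or
      \<open>r choose a\<close> is 0.\<close>
    also have "\<dots> = (\<Sum>a\<le>l. fact m * fact l * ((1 / of_nat r * binomial_fps A r $ a) * cycle_gf A \<mu> $ (l - a)))"
    proof (rule sum.mono_neutral_cong)
      show "of_nat ((l choose a) * (m choose (r - a))) * h a = 0" if "a \<in> {..r} - {..l}" for a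
        using that by (simp add: binomial_eq_0)
      show "fact m * fact l * ((1 / of_nat r * binomial_fps A r $ a) * cycle_gf A \<mu> $ (l - a)) = 0"
        if "a \<in> {..l} - {..r}" for a
        using that by (simp add: binomial_fps_def binomial_eq_0)
      show "of_nat ((l choose a) * (m choose (r - a))) * h a =
          fact m * fact l * ((1 / of_nat r * binomial_fps A r $ a) * cycle_gf A \<mu> $ (l - a))"
        if "a \<in> {..r} \<inter> {..l}" for a
      proof -
        have a: "a \<le> r" "a \<le> l" using that by auto
        consider "a \<notin> A" | "a \<in> A" "r - a > m" | "a \<in> A" "r - a \<le> m" by linarith
        then show ?thesis
        proof cases
          case 2
          \<comment> \<open>Here no \<open>C\<close> with \<open>card (C \<inter> L) = a\<close> exists; the coefficient vanishes for degree reasons.\<close>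
          have "(\<Sum>k\<in>nu_support \<mu>. k * \<mu> k) = l + m - r" using \<mu>(2) less.prems(3) lm by simp
          also have "\<dots> < l - a" using 2 a \<mu>(2) less.prems(3) lm by linarith
          finally have "cycle_gf A \<mu> $ (l - a) = 0" by (rule cycle_gf_nth_eq_0[OF \<mu>(1)])
          then show ?thesis by (simp add: h_def)
        next
          case 3
          \<comment> \<open>The factorials of the remaining points cancel against those in the
            binomials, leaving (r-1)! / (a! (r-a)!), which is (r choose a) / r.\<close>
          have "fact r = of_nat r * (fact (r - 1) :: rat)" using r0 by (simp add: fact_reduce)
          then show ?thesis
            using 3 a r0
            by (simp add: h_def binomial_fps_def binomial_fact field_simps)
        qed (simp add: h_def binomial_fps_def)
      qed
    qed auto
    also have "\<dots> = fact m * fact l * (fps_const (1 / of_nat r) * binomial_fps A r * cycle_gf A \<mu>) $ l"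
      by (simp add: fps_mult_nth[of "_ * _"] sum_distrib_left atLeast0AtMost)
    also have "\<dots> = fact m * fact l * (of_nat (\<nu> r) * cycle_gf A \<nu>) $ l"
      by (simp only: cycle_gf_rec[OF less.prems(2) r] \<mu>_def)
    also have "(of_nat (\<nu> r) * cycle_gf A \<nu>) $ l = of_nat (\<nu> r) * cycle_gf A \<nu> $ l"
      by (simp add: fps_of_nat[symmetric])
    finally show ?thesis using r0 by (simp add: l_def m_def)
  qed
qed

theorem theorem4p1:
  fixes N l :: nat and A :: "nat set" and \<nu> :: "nat \<Rightarrow> nat"
  assumes "2 \<le> l" and "l \<le> N"
    and "finite (nu_support \<nu>)"
    and "(\<Sum>r\<in>nu_support \<nu>. r * \<nu> r) = N"
  shows "(of_nat (Q N A \<nu> l) :: rat) =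
    fact (N - l) * fact l *
    fps_nth (\<Prod>r\<in>nu_support \<nu>.
       fps_const (1 / fact (\<nu> r)) * (fps_const (1 / of_nat r) * binomial_fps A r) ^ \<nu> r) l"
proof -
  have "Q N A \<nu> l = card (admissible_perms A {1..l} \<nu> {1..N})"
    by (simp add: Q_def admissible_perms_def admissible_def)
  \<comment> \<open>Since \<open>l \<le> N\<close>, all \<open>l\<close> marked points lie in the
    ground set.\<close>
  moreover have "card ({1..N} \<inter> {1..l}) = l" "card ({1..N} - {1..l}) = N - l"
    using assms(2) by (auto simp: card_Diff_subset min_def)
  ultimately show ?thesis
    using card_admissible_perms[of "{1..N}" \<nu> A "{1..l}"] assms(3,4)
    by (simp only: cycle_gf_def finite_atLeastAtMost card_atLeastAtMost diff_Suc_1 add_diff_cancel_right')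
qed

end
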